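(* Let $\mathcal{H}$ be a Hilbert space with orthonormal basis $\{e_n\}_{n\ge0}$, let $H_0$ be the self-adjoint operator with $H_0e_n=ne_n$ for all $n\ge 0$, let $T$ be a bounded operator on $\mathcal{H}$ with bounded inverse, put $\psi_n=(T^* )^{-1}e_n$, and let $\beta>0$. Let $$\omega_{\psi\psi}(X)=\frac{1}{Z_{\psi\psi}}\sum_{n\ge0}e^{-\beta n}\langle\psi_n,X\psi_n\rangle,\qquad Z_{\psi\psi}=\sum_{n\ge0}e^{-\beta n}\|\psi_n\|^2 .$$ For $B\in B(\mathcal{H})$ let ${}_TB:=(TT^* )B(TT^* )^{-1}$. Then for all $A,B\in B(\mathcal{H})$ $$\omega_{\psi\psi}\big(A\,\alpha_\psi^{i\beta}(B)\big)=\omega_{\psi\psi}\big({}_TB\,A\big).$$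
   Context: $B(\mathcal{H})$ is the algebra of bounded operators on $\mathcal{H}$; the inner product is linear in the second variable. For $t\in\mathbb{R}$ and $X\in B(\mathcal{H})$, $\alpha_0^t(X)=e^{iH_0t}Xe^{-iH_0t}$ and $\alpha_\psi^t(X)=(T^* )^{-1}\alpha_0^t\big(T^*X(T^* )^{-1}\big)T^*$. At the imaginary time $t=i\beta$ the same formulas are used, i.e. $\alpha_\psi^{i\beta}(B)=(T^* )^{-1}e^{-\beta H_0}T^*B(T^* )^{-1}e^{\beta H_0}T^*$, a possibly unbounded operator which is defined at least on the linear span of $\{\psi_n\}$. The functional $\omega_{\psi\psi}$ is applied to any (possibly unbounded) operator $X$ whose domain contains all $\psi_n$ and for which the defining series converges absolutely; part of the claim is that this is so for $X=A\,\alpha_\psi^{i\beta}(B)$. *)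

theory Defs
  imports "HOL-Analysis.Analysis"
begin

section \<open>Complex Hilbert spaces\<close>

text \<open>The inner product is linear in the second variable.\<close>

class complex_hilbert = banach +
  fixes scaleC :: "complex \<Rightarrow> 'a \<Rightarrow> 'a"  (infixr "*\<^sub>C" 75)
    and cinner :: "'a \<Rightarrow> 'a \<Rightarrow> complex"
  assumes scaleC_add_right: "c *\<^sub>C (x + y) = c *\<^sub>C x + c *\<^sub>C y"
    and scaleC_add_left: "(c + d) *\<^sub>C x = c *\<^sub>C x + d *\<^sub>C x"
    and scaleC_scaleC: "c *\<^sub>C d *\<^sub>C x = (c * d) *\<^sub>C x"
    and scaleC_one: "1 *\<^sub>C x = x"
    and scaleR_eq_scaleC: "r *\<^sub>R x = complex_of_real r *\<^sub>C x"
    and cinner_commute: "cinner x y = cnj (cinner y x)"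
    and cinner_add_right: "cinner x (y + z) = cinner x y + cinner x z"
    and cinner_scaleC_right: "cinner x (c *\<^sub>C y) = c * cinner x y"
    and cinner_self: "cinner x x = complex_of_real ((norm x)\<^sup>2)"

global_interpretation cvec: vector_space "scaleC :: complex \<Rightarrow> 'a \<Rightarrow> 'a::complex_hilbert"
  by unfold_locales
    (simp_all add: scaleC_add_right scaleC_add_left scaleC_scaleC scaleC_one)

definition orthonormal_basis :: "(nat \<Rightarrow> 'a::complex_hilbert) \<Rightarrow> bool" where
  "orthonormal_basis e \<longleftrightarrow>
     (\<forall>m n. cinner (e m) (e n) = (if m = n then 1 else 0)) \<and>
     closure (cvec.span (range e)) = UNIV"

section \<open>Bounded operators\<close>

definition bounded_op :: "('a::complex_hilbert \<Rightarrow> 'a) \<Rightarrow> bool" where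
  "bounded_op A \<longleftrightarrow> bounded_linear A \<and> (\<forall>c x. A (c *\<^sub>C x) = c *\<^sub>C A x)"

definition cadjoint :: "('a::complex_hilbert \<Rightarrow> 'a) \<Rightarrow> ('a \<Rightarrow> 'a)" where
  "cadjoint A = (THE S. \<forall>x y. cinner (S x) y = cinner x (A y))"

section \<open>Possibly unbounded operators\<close>

text \<open>A possibly unbounded operator is a partial function; its domain is \<^const>\<open>dom\<close>,
  and \<^const>\<open>map_comp\<close> is the product with its natural domain.\<close>

definition everywhere :: "('a \<Rightarrow> 'a) \<Rightarrow> ('a \<rightharpoonup> 'a)" where
  "everywhere A = (\<lambda>x. Some (A x))"

definition op_linear :: "('a::complex_hilbert \<rightharpoonup> 'a) \<Rightarrow> bool" where
  "op_linear S \<longleftrightarrow> cvec.subspace (dom S) \<and>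
     (\<forall>x\<in>dom S. \<forall>y\<in>dom S. the (S (x + y)) = the (S x) + the (S y)) \<and>
     (\<forall>c. \<forall>x\<in>dom S. the (S (c *\<^sub>C x)) = c *\<^sub>C the (S x))"

definition op_adjoint :: "('a::complex_hilbert \<rightharpoonup> 'a) \<Rightarrow> ('a \<rightharpoonup> 'a)" where
  "op_adjoint S y =
     (if \<exists>z. \<forall>x\<in>dom S. cinner z x = cinner y (the (S x))
      then Some (THE z. \<forall>x\<in>dom S. cinner z x = cinner y (the (S x)))
      else None)"

definition self_adjoint :: "('a::complex_hilbert \<rightharpoonup> 'a) \<Rightarrow> bool" where
  "self_adjoint S \<longleftrightarrow> op_linear S \<and> closure (dom S) = UNIV \<and> op_adjoint S = S"

section \<open>Functional calculus\<close>

definition eigenspace :: "('a::complex_hilbert \<rightharpoonup> 'a) \<Rightarrow> complex \<Rightarrow> 'a set" where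
  "eigenspace S l = {x. S x = Some (l *\<^sub>C x)}"

definition eigenvalues :: "('a::complex_hilbert \<rightharpoonup> 'a) \<Rightarrow> complex set" where
  "eigenvalues S = {l. \<exists>x\<in>eigenspace S l. x \<noteq> 0}"

definition orth_proj :: "'a::complex_hilbert set \<Rightarrow> 'a \<Rightarrow> 'a" where
  "orth_proj M x = (THE y. y \<in> M \<and> (\<forall>z\<in>M. cinner z (x - y) = 0))"

text \<open>The Borel functional calculus \<open>f(S) = \<integral> f dE\<close>, on its maximal domain, for a
  self-adjoint \<open>S\<close> with pure point spectrum, i.e. whose eigenvectors span a dense subspace:
  then the spectral measure is the sum of the eigenprojections.  It is not meant for
  operators with continuous spectrum.\<close>

definition fun_calc ::
    "(complex \<Rightarrow> complex) \<Rightarrow> ('a::complex_hilbert \<rightharpoonup> 'a) \<Rightarrow> ('a \<rightharpoonup> 'a)" where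
  "fun_calc f S x =
     (if (\<lambda>l. (cmod (f l))\<^sup>2 * (norm (orth_proj (eigenspace S l) x))\<^sup>2)
           summable_on eigenvalues S
      then Some (\<Sum>\<^sub>\<infinity>l\<in>eigenvalues S. f l *\<^sub>C orth_proj (eigenspace S l) x)
      else None)"

definition exp_op :: "complex \<Rightarrow> ('a::complex_hilbert \<rightharpoonup> 'a) \<Rightarrow> ('a \<rightharpoonup> 'a)" where
  "exp_op z S = fun_calc (\<lambda>l. exp (z * l)) S"

section \<open>Dynamics\<close>

text \<open>The time \<open>z\<close> may be complex; real times give the usual evolution.\<close>

definition alpha_0 ::
    "('a::complex_hilbert \<rightharpoonup> 'a) \<Rightarrow> complex \<Rightarrow> ('a \<Rightarrow> 'a) \<Rightarrow> ('a \<rightharpoonup> 'a)" where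
  "alpha_0 H z X = exp_op (\<i> * z) H \<circ>\<^sub>m everywhere X \<circ>\<^sub>m exp_op (- \<i> * z) H"

definition alpha_psi ::
    "('a::complex_hilbert \<rightharpoonup> 'a) \<Rightarrow> ('a \<Rightarrow> 'a) \<Rightarrow> complex \<Rightarrow> ('a \<Rightarrow> 'a) \<Rightarrow> ('a \<rightharpoonup> 'a)" where
  "alpha_psi H T z X =
     everywhere (inv (cadjoint T)) \<circ>\<^sub>m
     alpha_0 H z (cadjoint T \<circ> X \<circ> inv (cadjoint T)) \<circ>\<^sub>m
     everywhere (cadjoint T)"

section \<open>The functional\<close>

definition Z_psi :: "real \<Rightarrow> (nat \<Rightarrow> 'a::complex_hilbert) \<Rightarrow> real" where
  "Z_psi \<beta> \<psi> = (\<Sum>n. exp (- \<beta> * real n) * (norm (\<psi> n))\<^sup>2)"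

definition omega :: "real \<Rightarrow> (nat \<Rightarrow> 'a::complex_hilbert) \<Rightarrow> ('a \<rightharpoonup> 'a) \<Rightarrow> complex" where
  "omega \<beta> \<psi> X =
     1 / complex_of_real (Z_psi \<beta> \<psi>) *
     (\<Sum>n. complex_of_real (exp (- \<beta> * real n)) * cinner (\<psi> n) (the (X (\<psi> n))))"

text \<open>Without this condition the value of \<^const>\<open>omega\<close> is meaningless.\<close>

definition omega_defined :: "real \<Rightarrow> (nat \<Rightarrow> 'a::complex_hilbert) \<Rightarrow> ('a \<rightharpoonup> 'a) \<Rightarrow> bool" where
  "omega_defined \<beta> \<psi> X \<longleftrightarrow>
     summable (\<lambda>n. exp (- \<beta> * real n) * (norm (\<psi> n))\<^sup>2) \<and>
     range \<psi> \<subseteq> dom X \<and>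
     summable (\<lambda>n. cmod (complex_of_real (exp (- \<beta> * real n)) * cinner (\<psi> n) (the (X (\<psi> n)))))"

definition T_conj :: "('a::complex_hilbert \<Rightarrow> 'a) \<Rightarrow> ('a \<Rightarrow> 'a) \<Rightarrow> ('a \<Rightarrow> 'a)" where
  "T_conj T B = (T \<circ> cadjoint T) \<circ> B \<circ> inv (T \<circ> cadjoint T)"

end

theory Submission
  imports Defs
begin

text \<open>Write \<open>K = exp (- \<beta> H0)\<close>, \<open>C = T* B (T*)\<inverse>\<close> and \<open>D = T\<inverse> A (T*)\<inverse>\<close>.  Since
  \<open>\<psi> n = (T*)\<inverse> (e n)\<close>, the factor \<open>exp (- \<beta> n)\<close> cancels the one produced by
  \<open>exp (\<beta> H0) (e n)\<close>, and the two sides become \<open>Tr (D K C)\<close> and \<open>Tr (K C D)\<close>, up to the same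
  normalisation.\<close>

section \<open>The inner product\<close>

lemma cinner_add_left: "cinner (x + y) z = cinner x z + cinner y z"
  for x y z :: "'a::complex_hilbert"
  by (metis cinner_add_right cinner_commute complex_cnj_add)

lemma cinner_scaleC_left: "cinner (c *\<^sub>C x) y = cnj c * cinner x y"
  for x y :: "'a::complex_hilbert"
  by (metis cinner_scaleC_right cinner_commute complex_cnj_mult)

lemma norm_scaleC: "norm (c *\<^sub>C x) = cmod c * norm x"
  for x :: "'a::complex_hilbert"
proof -
  have "complex_of_real ((norm (c *\<^sub>C x))\<^sup>2) = cnj c * c * complex_of_real ((norm x)\<^sup>2)"
    by (simp only: cinner_self[symmetric] cinner_scaleC_left cinner_scaleC_right ac_simps)
  also have "\<dots> = complex_of_real ((cmod c * norm x)\<^sup>2)"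
    using complex_norm_square[of c] by (simp add: power_mult_distrib mult.commute)
  finally have "(norm (c *\<^sub>C x))\<^sup>2 = (cmod c * norm x)\<^sup>2"
    using of_real_eq_iff by blast
  then show ?thesis
    by (simp add: power2_eq_iff_nonneg)
qed

lemma cinner_0_right [simp]: "cinner x 0 = 0" for x :: "'a::complex_hilbert"
  using cinner_add_right[of x 0 0] by simp

lemma cinner_0_left [simp]: "cinner 0 x = 0" for x :: "'a::complex_hilbert"
  using cinner_add_left[of 0 0 x] by simp

lemma cinner_diff_right: "cinner x (y - z) = cinner x y - cinner x z"
  for x y z :: "'a::complex_hilbert"
  using cinner_add_right[of x "y - z" z] by simp

lemma cinner_diff_left: "cinner (x - y) z = cinner x z - cinner y z"
  for x y z :: "'a::complex_hilbert"
  using cinner_add_left[of "x - y" y z] by simp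

lemma cinner_sum_right: "cinner x (\<Sum>i\<in>I. f i) = (\<Sum>i\<in>I. cinner x (f i))"
  for x :: "'a::complex_hilbert"
  by (induction I rule: infinite_finite_induct) (auto simp: cinner_add_right)

lemma cinner_sum_left: "cinner (\<Sum>i\<in>I. f i) x = (\<Sum>i\<in>I. cinner (f i) x)"
  for x :: "'a::complex_hilbert"
  by (induction I rule: infinite_finite_induct) (auto simp: cinner_add_left)

lemma cinner_eq_0_iff [simp]: "cinner x x = 0 \<longleftrightarrow> x = 0" for x :: "'a::complex_hilbert"
  by (simp add: cinner_self)

lemma cmod_cinner_commute: "cmod (cinner x y) = cmod (cinner y x)"
  for x y :: "'a::complex_hilbert"
  by (metis cinner_commute complex_mod_cnj)

text \<open>Removing from \<open>y\<close> its projection \<open>c *\<^sub>C x\<close> leaves a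
  vector of squared norm |y|^2 - |<x,y>|^2 / |x|^2, and this cannot be negative.\<close>

lemma cauchy_schwarz: "cmod (cinner x y) \<le> norm x * norm y"
  for x y :: "'a::complex_hilbert"
proof (cases "x = 0")
  case False
  then have x: "norm x > 0" by simp
  define c where "c = cinner x y / complex_of_real ((norm x)\<^sup>2)"
  have *: "cinner x (y - c *\<^sub>C x) = 0"
    using x by (simp add: cinner_diff_right cinner_scaleC_right cinner_self c_def)
  have "cinner (y - c *\<^sub>C x) (y - c *\<^sub>C x) = cinner y y - c * cinner y x"
    unfolding cinner_diff_left[of y] cinner_scaleC_left *
    by (simp add: cinner_diff_right cinner_scaleC_right)
  also have "c * cinner y x = complex_of_real ((cmod (cinner x y))\<^sup>2 / (norm x)\<^sup>2)"
    using complex_norm_square[of "cinner x y"] by (simp add: c_def cinner_commute[of y x])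
  finally have "complex_of_real ((norm (y - c *\<^sub>C x))\<^sup>2)
      = complex_of_real ((norm y)\<^sup>2 - (cmod (cinner x y))\<^sup>2 / (norm x)\<^sup>2)"
    by (simp add: cinner_self)
  then have "(norm (y - c *\<^sub>C x))\<^sup>2 = (norm y)\<^sup>2 - (cmod (cinner x y))\<^sup>2 / (norm x)\<^sup>2"
    using of_real_eq_iff by blast
  then have "(cmod (cinner x y))\<^sup>2 / (norm x)\<^sup>2 \<le> (norm y)\<^sup>2"
    by (metis diff_ge_0_iff_ge zero_le_power2)
  then have "(cmod (cinner x y))\<^sup>2 \<le> (norm x * norm y)\<^sup>2"
    using x by (simp add: field_simps power_mult_distrib)
  then show ?thesis
    by (rule power2_le_imp_le) simp
qed simp

lemma bounded_linear_cinner_right: "bounded_linear (cinner x)" for x :: "'a::complex_hilbert"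
  by (rule bounded_linear_intro[of _ "norm x"])
    (auto simp: cinner_add_right scaleR_eq_scaleC cinner_scaleC_right scaleR_conv_of_real
       cauchy_schwarz mult.commute[of _ "norm x"])

text \<open>In its first variable the inner product is only conjugate-linear, but that is still
  real-linear, which is all that \<open>bounded_linear\<close> asks for.\<close>

lemma bounded_linear_cinner_left: "bounded_linear (\<lambda>x. cinner x y)" for y :: "'a::complex_hilbert"
  by (rule bounded_linear_intro[of _ "norm y"])
    (auto simp: cinner_add_left scaleR_eq_scaleC cinner_scaleC_left scaleR_conv_of_real
       cauchy_schwarz)

lemma bounded_linear_scaleC: "bounded_linear (scaleC c :: 'a::complex_hilbert \<Rightarrow> 'a)"
  by (rule bounded_linear_intro[of _ "cmod c"])
    (auto simp: scaleC_add_right scaleR_eq_scaleC scaleC_scaleC norm_scaleC mult.commute)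

text \<open>The vectors orthogonal to \<open>y\<close> form a closed set; once it contains a dense
  set it contains \<open>y\<close> itself.\<close>

lemma cinner_dense_eq_0:
  fixes y :: "'a::complex_hilbert"
  assumes "closure D = UNIV" "\<And>x. x \<in> D \<Longrightarrow> cinner x y = 0"
  shows "y = 0"
proof -
  have "closed {x. cinner x y = 0}"
    by (intro closed_Collect_eq continuous_on_const
        bounded_linear.continuous_on[OF bounded_linear_cinner_left] continuous_on_id)
  then have "closure D \<subseteq> {x. cinner x y = 0}"
    using assms(2) by (intro closure_minimal) auto
  then have "cinner y y = 0" using assms(1) by blast
  then show ?thesis by simp
qed

section \<open>Bounded operators\<close>

lemma bounded_op_scaleC: "bounded_op A \<Longrightarrow> A (c *\<^sub>C x) = c *\<^sub>C A x"
  by (simp add: bounded_op_def)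

lemma bounded_op_imp_bounded_linear: "bounded_op A \<Longrightarrow> bounded_linear A"
  by (simp add: bounded_op_def)

lemma bounded_op_compose: "bounded_op A \<Longrightarrow> bounded_op B \<Longrightarrow> bounded_op (A \<circ> B)"
  using bounded_linear_compose[of A B] by (auto simp: bounded_op_def o_def)

lemma bounded_op_bound:
  assumes "bounded_op A"
  obtains K where "K \<ge> 0" "\<And>x. norm (A x) \<le> K * norm x"
  using bounded_linear.nonneg_bounded[OF bounded_op_imp_bounded_linear[OF assms]]
  by (metis mult.commute)

section \<open>Orthonormal bases\<close>

locale onb =
  fixes e :: "nat \<Rightarrow> 'a::complex_hilbert"
  assumes onb: "orthonormal_basis e"
begin

lemma cinner_basis: "cinner (e m) (e n) = (if m = n then 1 else 0)"
  using onb by (simp add: orthonormal_basis_def)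

lemma norm_basis [simp]: "norm (e n) = 1"
proof -
  have "(norm (e n))\<^sup>2 = 1"
    using cinner_self[of "e n"] cinner_basis[of n n] of_real_eq_1_iff by metis
  then show ?thesis by (simp add: power2_eq_1_iff)
      (metis norm_ge_zero not_one_le_zero neg_0_le_iff_le)
qed

lemma basis_neq_0: "e n \<noteq> 0"
  using norm_basis[of n] by (metis norm_zero zero_neq_one)

lemma basis_coeffs_0_imp_0:
  assumes "\<And>n. cinner (e n) x = 0"
  shows "x = 0"
proof (rule cinner_dense_eq_0)
  show "closure (cvec.span (range e)) = UNIV"
    using onb by (simp add: orthonormal_basis_def)
  fix y assume "y \<in> cvec.span (range e)"
  then show "cinner y x = 0"
    by (induction rule: cvec.span_induct_alt)
      (auto simp: assms cinner_add_left cinner_scaleC_left)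
qed

lemma norm_sum_basis:
  assumes "finite F"
  shows "(norm (\<Sum>n\<in>F. a n *\<^sub>C e n))\<^sup>2 = (\<Sum>n\<in>F. (cmod (a n))\<^sup>2)"
proof -
  have "complex_of_real ((norm (\<Sum>n\<in>F. a n *\<^sub>C e n))\<^sup>2)
      = (\<Sum>n\<in>F. \<Sum>m\<in>F. a n * (cnj (a m) * cinner (e m) (e n)))"
    by (simp only: cinner_self[symmetric] cinner_sum_left cinner_sum_right cinner_scaleC_left
        cinner_scaleC_right sum_distrib_left)
  also have "\<dots> = (\<Sum>n\<in>F. \<Sum>m\<in>F. if n = m then a n * cnj (a n) else 0)"
    by (intro sum.cong refl) (auto simp: cinner_basis)
  also have "\<dots> = (\<Sum>n\<in>F. a n * cnj (a n))"
    using assms by simp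
  also have "\<dots> = complex_of_real (\<Sum>n\<in>F. (cmod (a n))\<^sup>2)"
    unfolding of_real_sum by (intro sum.cong refl complex_norm_square[symmetric])
  finally show ?thesis using of_real_eq_iff by blast
qed

text \<open>For the projection \<open>u\<close> of \<open>x\<close> onto the span of the chosen
  basis vectors, <u,x> = |u|^2. Cauchy-Schwarz then gives |u|^2 \<le> |u| |x|, and cancelling |u|
  leaves |u| \<le> |x|.\<close>

lemma bessel:
  assumes "finite F"
  shows "(\<Sum>n\<in>F. (cmod (cinner (e n) x))\<^sup>2) \<le> (norm x)\<^sup>2"
proof -
  define u where "u = (\<Sum>n\<in>F. cinner (e n) x *\<^sub>C e n)"
  define S where "S = (\<Sum>n\<in>F. (cmod (cinner (e n) x))\<^sup>2)"
  have u: "(norm u)\<^sup>2 = S"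
    unfolding u_def S_def by (rule norm_sum_basis[OF assms])
  have "cinner u x = (\<Sum>n\<in>F. complex_of_real ((cmod (cinner (e n) x))\<^sup>2))"
    unfolding u_def cinner_sum_left cinner_scaleC_left
    by (intro sum.cong refl) (metis complex_norm_square mult.commute)
  then have "cinner u x = complex_of_real S" by (simp add: S_def)
  moreover have "S \<ge> 0" by (simp add: S_def sum_nonneg)
  ultimately have "S \<le> norm u * norm x"
    using cauchy_schwarz[of u x] by simp
  then have "norm u * norm u \<le> norm u * norm x"
    using u by (simp add: power2_eq_square)
  then have "norm u \<le> norm x"
    by (cases "norm u = 0") auto
  then have "(norm u)\<^sup>2 \<le> (norm x)\<^sup>2" by (simp add: power_mono)
  then show ?thesis using u S_def by simp
qed

section \<open>Expansions in the basis and Parseval's identity\<close>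

lemma bessel_summable: "summable (\<lambda>n. (cmod (cinner (e n) x))\<^sup>2)"
  by (rule summableI_nonneg_bounded[of _ "(norm x)\<^sup>2"]) (auto intro: bessel)

text \<open>By Pythagoras the squared norm of a block of the vector series is the same block of the
  numerical series, so the Cauchy criterion carries over and completeness gives the limit.\<close>

lemma summable_basis:
  assumes "summable (\<lambda>n. (cmod (a n))\<^sup>2)"
  shows "summable (\<lambda>n. a n *\<^sub>C e n)"
  unfolding summable_Cauchy
proof (intro allI impI)
  fix r :: real assume "r > 0"
  then have "r\<^sup>2 > 0" by simp
  then obtain N where N: "\<And>m n. m \<ge> N \<Longrightarrow> norm (\<Sum>k=m..<n. (cmod (a k))\<^sup>2) < r\<^sup>2"
    using assms[unfolded summable_Cauchy] by blast
  have "norm (\<Sum>k=m..<n. a k *\<^sub>C e k) < r" if "m \<ge> N" for m n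
  proof -
    have "(norm (\<Sum>k=m..<n. a k *\<^sub>C e k))\<^sup>2 < r\<^sup>2"
      unfolding norm_sum_basis[OF finite_atLeastLessThan]
      using N[OF that, of n] unfolding real_norm_def by linarith
    then show ?thesis using \<open>r > 0\<close> by (rule power2_less_imp_less[OF _ less_imp_le])
  qed
  then show "\<exists>N. \<forall>m\<ge>N. \<forall>n. norm (sum (\<lambda>n. a n *\<^sub>C e n) {m..<n}) < r" by blast
qed

lemma cinner_basis_sums:
  assumes "(\<lambda>n. a n *\<^sub>C e n) sums x"
  shows "cinner (e m) x = a m"
proof -
  have "(\<lambda>n. cinner (e m) (a n *\<^sub>C e n)) sums cinner (e m) x"
    by (rule bounded_linear.sums[OF bounded_linear_cinner_right assms])
  moreover have "(\<lambda>n. cinner (e m) (a n *\<^sub>C e n)) = (\<lambda>n. if n = m then a n else 0)"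
    by (auto simp: cinner_scaleC_right cinner_basis)
  ultimately show ?thesis using sums_single[of m a] sums_unique2 by metis
qed

lemma basis_expansion: "(\<lambda>n. cinner (e n) x *\<^sub>C e n) sums x"
proof -
  obtain y where y: "(\<lambda>n. cinner (e n) x *\<^sub>C e n) sums y"
    using summable_basis[OF bessel_summable] summable_def by blast
  \<comment> \<open>The expansion converges to some \<open>y\<close> with the same coefficients as
    \<open>x\<close>; totality of the basis identifies the two.\<close>
  have "x - y = 0"
    by (rule basis_coeffs_0_imp_0) (simp add: cinner_diff_right cinner_basis_sums[OF y])
  then show ?thesis using y by simp
qed

lemma parseval: "(\<lambda>n. cinner x (e n) * cinner (e n) y) sums cinner x y"
  using bounded_linear.sums[OF bounded_linear_cinner_right basis_expansion, of x y]
  by (simp add: cinner_scaleC_right mult.commute)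

text \<open>Cauchy-Schwarz for finite sequences followed by Bessel. The bound does not depend on
  \<open>F\<close>, which yields absolute summability of the Parseval series.\<close>

lemma bessel_product:
  "finite F \<Longrightarrow> (\<Sum>n\<in>F. cmod (cinner x (e n) * cinner (e n) y)) \<le> norm x * norm y"
proof -
  assume F: "finite F"
  have "(\<Sum>n\<in>F. cmod (cinner x (e n) * cinner (e n) y))
      = (\<Sum>n\<in>F. \<bar>cmod (cinner (e n) x)\<bar> * \<bar>cmod (cinner (e n) y)\<bar>)"
    by (simp add: norm_mult cmod_cinner_commute[of x])
  also have "\<dots> \<le> L2_set (\<lambda>n. cmod (cinner (e n) x)) F * L2_set (\<lambda>n. cmod (cinner (e n) y)) F"
    by (rule L2_set_mult_ineq)
  also have "\<dots> \<le> norm x * norm y"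
    unfolding L2_set_def using bessel[OF F]
    by (intro mult_mono real_le_lsqrt) (auto intro: sum_nonneg)
  finally show ?thesis .
qed

lemma parseval_abs_summable: "(\<lambda>n. cmod (cinner x (e n) * cinner (e n) y)) summable_on UNIV"
  unfolding Infinite_Sum.abs_summable_iff_bdd_above
  by (rule bdd_aboveI2[where M = "norm x * norm y"]) (auto intro: bessel_product)

text \<open>Absolute convergence provides an unordered sum, whose value must agree with the ordered
  one. The unordered form is what the exchange of summations in \<open>trace_cyclic\<close> works
  with.\<close>

lemma parseval_has_sum: "((\<lambda>n. cinner x (e n) * cinner (e n) y) has_sum cinner x y) UNIV"
proof -
  note * = has_sum_infsum[OF Infinite_Sum.abs_summable_summable[OF parseval_abs_summable[of x y]]]
  show ?thesis using * unfolding sums_unique2[OF has_sum_imp_sums[OF *] parseval] .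
qed

lemma parseval_infsum_norm_le:
  "(\<Sum>\<^sub>\<infinity>n. cmod (cinner x (e n) * cinner (e n) y)) \<le> norm x * norm y"
  by (rule infsum_le_finite_sums[OF parseval_abs_summable]) (auto intro: bessel_product)

section \<open>Riesz representation and adjoints\<close>

lemma riesz:
  fixes f :: "'a \<Rightarrow> complex"
  assumes f: "bounded_linear f" and scale: "\<And>c x. f (c *\<^sub>C x) = c * f x"
  obtains z where "\<And>x. cinner z x = f x"
proof -
  obtain K where K: "K \<ge> 0" "\<And>x. norm (f x) \<le> norm x * K"
    using bounded_linear.nonneg_bounded[OF f] by blast
  interpret f: bounded_linear f by fact
  have "(\<Sum>n<N. (cmod (f (e n)))\<^sup>2) \<le> K\<^sup>2" for N
  proof -
    \<comment> \<open>A partial sum of the intended representing vector. Here f(u) = |u|^2, so the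
      bound on \<open>f\<close> gives |u|^2 \<le> |u| K and thus |u| \<le> K, uniformly in
      \<open>N\<close>.\<close>
    define u where "u = (\<Sum>n<N. cnj (f (e n)) *\<^sub>C e n)"
    define S where "S = (\<Sum>n<N. (cmod (f (e n)))\<^sup>2)"
    have u: "(norm u)\<^sup>2 = S"
      unfolding u_def S_def by (subst norm_sum_basis) auto
    have "f u = (\<Sum>n<N. complex_of_real ((cmod (f (e n)))\<^sup>2))"
      unfolding u_def f.sum scale
      by (intro sum.cong refl) (metis complex_norm_square mult.commute)
    then have "f u = complex_of_real S" by (simp add: S_def)
    moreover have "S \<ge> 0" by (simp add: S_def sum_nonneg)
    ultimately have "S \<le> norm u * K"
      using K(2)[of u] by simp
    then have "norm u * norm u \<le> norm u * K"
      using u by (simp add: power2_eq_square)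
    then have "norm u \<le> K"
      using K(1) by (cases "norm u = 0") auto
    then have "(norm u)\<^sup>2 \<le> K\<^sup>2" by (simp add: power_mono)
    then show ?thesis using u S_def by simp
  qed
  then have "summable (\<lambda>n. (cmod (cnj (f (e n))))\<^sup>2)"
    by (intro summableI_nonneg_bounded[of _ "K\<^sup>2"]) auto
  from summable_basis[OF this] obtain z where z: "(\<lambda>n. cnj (f (e n)) *\<^sub>C e n) sums z"
    using summable_def by blast
  have "cinner z x = f x" for x
  proof -
    have "(\<lambda>n. f (cinner (e n) x *\<^sub>C e n)) sums f x"
      by (rule f.sums[OF basis_expansion])
    moreover have "f (cinner (e n) x *\<^sub>C e n) = cinner z (e n) * cinner (e n) x" for n
      using cinner_basis_sums[OF z, of n] cinner_commute[of z "e n"] by (simp add: scale)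
    ultimately have "(\<lambda>n. cinner z (e n) * cinner (e n) x) sums f x" by simp
    then show ?thesis by (rule sums_unique2[OF parseval])
  qed
  then show ?thesis by (rule that)
qed

lemma cadjoint_exists:
  assumes "bounded_op A"
  shows "\<exists>S. \<forall>x y. cinner (S x) y = cinner x (A y :: 'a)"
proof -
  have "\<exists>z. \<forall>y. cinner z y = cinner x (A y)" for x
  proof -
    have lin: "bounded_linear (\<lambda>y. cinner x (A y))"
      by (rule bounded_linear_compose[OF bounded_linear_cinner_right
            bounded_op_imp_bounded_linear[OF assms]])
    have scale: "cinner x (A (c *\<^sub>C y)) = c * cinner x (A y)" for c y
      by (simp add: bounded_op_scaleC[OF assms] cinner_scaleC_right)
    show ?thesis by (rule riesz[OF lin scale]) blast
  qed
  then show ?thesis by (intro choice allI)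
qed

lemma cinner_ext:
  assumes "\<And>x. cinner x y = cinner x z"
  shows "y = (z :: 'a)"
proof -
  have "cinner (y - z) (y - z) = 0"
    unfolding cinner_diff_right[of "y - z"] by (simp only: assms diff_self)
  then show ?thesis by simp
qed

text \<open>Since \<open>cadjoint\<close> is a definite description, its defining equation becomes
  available only after existence, from Riesz, is combined with uniqueness.\<close>

lemma cinner_cadjoint:
  assumes "bounded_op A"
  shows "cinner (cadjoint A x) y = cinner x (A y :: 'a)"
proof -
  have eq: "S = S'" if S: "\<forall>x y. cinner (S x) y = cinner x (A y)"
    and S': "\<forall>x y. cinner (S' x) y = cinner x (A y)" for S S' :: "'a \<Rightarrow> 'a"
  proof (rule ext, rule cinner_ext)
    fix x y
    have "cinner (S x) y = cinner (S' x) y"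
      using S[rule_format, of x y] S'[rule_format, of x y] by (rule trans[OF _ sym])
    then show "cinner y (S x) = cinner y (S' x)"
      unfolding cinner_commute[of y "S x"] cinner_commute[of y "S' x"] by (rule arg_cong)
  qed
  obtain S where S: "\<forall>x y. cinner (S x) y = cinner x (A y)"
    using cadjoint_exists[OF assms] by blast
  have "cadjoint A = S"
    unfolding cadjoint_def
  proof (rule the_equality)
    show "S' = S" if "\<forall>x y. cinner (S' x) y = cinner x (A y)" for S'
      by (rule eq[OF that S])
  qed (fact S)
  with S show ?thesis by blast
qed

lemma cinner_cadjoint_right:
  assumes "bounded_op A"
  shows "cinner y (cadjoint A x) = cinner (A y) (x :: 'a)"
  using arg_cong[where f = cnj, OF cinner_cadjoint[OF assms, of x y]]
  unfolding cinner_commute[symmetric] .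

text \<open>For u = \<open>cadjoint A x\<close> one has |u|^2 = <x, A u> \<le> |x| K |u|; cancelling
  |u| bounds the adjoint by the constant of \<open>A\<close>. Linearity is tested against arbitrary
  vectors.\<close>

lemma bounded_op_cadjoint:
  assumes A: "bounded_op (A :: 'a \<Rightarrow> 'a)"
  shows "bounded_op (cadjoint A)"
proof -
  obtain K where K: "K \<ge> 0" "\<And>x. norm (A x) \<le> K * norm x"
    using bounded_op_bound[OF A] by blast
  have scale: "cadjoint A (c *\<^sub>C x) = c *\<^sub>C cadjoint A x" for c x
    by (rule cinner_ext) (simp add: cinner_cadjoint_right[OF A] cinner_scaleC_right)
  have "norm (cadjoint A x) \<le> norm x * K" for x
  proof -
    let ?u = "cadjoint A x"
    have "complex_of_real ((norm ?u)\<^sup>2) = cinner x (A ?u)"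
      by (simp only: cinner_self[symmetric] cinner_cadjoint[OF A])
    then have "(norm ?u)\<^sup>2 = cmod (cinner x (A ?u))"
      by (metis norm_of_real abs_power2)
    also have "\<dots> \<le> norm x * norm (A ?u)" by (rule cauchy_schwarz)
    also have "\<dots> \<le> norm x * (K * norm ?u)" by (intro mult_left_mono K) auto
    finally have "norm ?u * norm ?u \<le> norm ?u * (norm x * K)"
      by (simp add: power2_eq_square ac_simps)
    then show ?thesis using K(1) by (cases "norm ?u = 0") auto
  qed
  moreover have "cadjoint A (x + y) = cadjoint A x + cadjoint A y" for x y
    by (rule cinner_ext) (simp add: cinner_cadjoint_right[OF A] cinner_add_right)
  ultimately have "bounded_linear (cadjoint A)"
    by (intro bounded_linear_intro) (auto simp: scaleR_eq_scaleC scale)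
  then show ?thesis by (simp add: bounded_op_def scale)
qed

text \<open>Adjoints reverse products. Applied to \<open>T\<close> and \<open>inv T\<close> in both
  orders, this identifies the inverse of \<open>cadjoint T\<close> as a bounded operator.\<close>

lemma cadjoint_compose_inv:
  assumes A: "bounded_op (A :: 'a \<Rightarrow> 'a)" and A': "bounded_op A'" and id: "A \<circ> A' = id"
  shows "cadjoint A' \<circ> cadjoint A = id"
proof
  fix x
  show "(cadjoint A' \<circ> cadjoint A) x = id x"
    by (rule cinner_ext)
      (use fun_cong[OF id] in \<open>simp add: cinner_cadjoint_right[OF A] cinner_cadjoint_right[OF A']\<close>)
qed

text \<open>\<open>Tr (D K C) = Tr (K C D)\<close> by exchanging the order of summation: the double series
  is dominated, by Bessel, by a multiple of \<open>\<Sum> \<bar>w m\<bar>\<close>.\<close>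

lemma trace_cyclic:
  fixes w :: "nat \<Rightarrow> complex"
  assumes w: "(\<lambda>n. cmod (w n)) summable_on UNIV"
    and K: "\<And>y. ((\<lambda>m. w m *\<^sub>C (cinner (e m) y *\<^sub>C e m)) has_sum K y) UNIV"
    and C: "bounded_op C" and D: "bounded_op D"
  obtains s where "((\<lambda>n. cinner (e n) (D (K (C (e n))))) has_sum s) UNIV"
    and "((\<lambda>m. w m * cinner (e m) (C (D (e m)))) has_sum s) UNIV"
proof -
  define f where "f = (\<lambda>(m, n). w m * (cinner (e m) (C (e n)) * cinner (e n) (D (e m))))"
  \<comment> \<open>With \<open>C\<close> moved to the left, the sum over \<open>n\<close> for fixed
    \<open>m\<close> is a Parseval series for the vectors \<open>cadjoint C (e m)\<close> and
    \<open>D (e m)\<close>.\<close>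
  have C': "cinner (e m) (C (e n)) = cinner (cadjoint C (e m)) (e n)" for m n
    by (simp add: cinner_cadjoint[OF C])
  obtain k where k: "k \<ge> 0" "\<And>x. norm (cadjoint C x) \<le> k * norm x"
    using bounded_op_bound[OF bounded_op_cadjoint[OF C]] by blast
  obtain l where l: "l \<ge> 0" "\<And>x. norm (D x) \<le> l * norm x"
    using bounded_op_bound[OF D] by blast
  have inner_abs: "(\<lambda>n. cmod (f (m, n))) summable_on UNIV" for m
    using summable_on_cmult_right[OF parseval_abs_summable[of "cadjoint C (e m)" "D (e m)"],
        of "cmod (w m)"]
    by (simp add: f_def C' norm_mult)
  have bound: "(\<Sum>\<^sub>\<infinity>n. norm (f (m, n))) \<le> cmod (w m) * (k * l)" for m
  proof -
    have "(\<Sum>\<^sub>\<infinity>n. norm (f (m, n)))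
        = cmod (w m) * (\<Sum>\<^sub>\<infinity>n. cmod (cinner (cadjoint C (e m)) (e n) * cinner (e n) (D (e m))))"
      unfolding f_def C' prod.case norm_mult[of "w m"] by (rule infsum_cmult_right')
    also have "\<dots> \<le> cmod (w m) * (norm (cadjoint C (e m)) * norm (D (e m)))"
      by (intro mult_left_mono parseval_infsum_norm_le) simp
    \<comment> \<open>The basis vectors have norm 1, so the operator bounds make the estimate
      uniform in \<open>m\<close> apart from the weight.\<close>
    also have "\<dots> \<le> cmod (w m) * (k * l)"
      using k(1) k(2)[of "e m"] l(2)[of "e m"] by (intro mult_left_mono mult_mono) auto
    finally show ?thesis .
  qed
  have outer_abs: "(\<lambda>m. norm (\<Sum>\<^sub>\<infinity>n. norm (f (m, n)))) summable_on UNIV"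
  proof (rule Infinite_Sum.abs_summable_on_comparison_test'[of "\<lambda>m. cmod (w m) * (k * l)"])
    show "(\<lambda>m. cmod (w m) * (k * l)) summable_on UNIV"
      by (rule summable_on_cmult_left[OF w])
    show "norm (\<Sum>\<^sub>\<infinity>n. norm (f (m, n))) \<le> cmod (w m) * (k * l)" for m
      using bound[of m] by (simp add: infsum_nonneg)
  qed
  \<comment> \<open>Tonelli: absolutely summable rows whose sums of moduli are themselves
    summable.\<close>
  have "(\<lambda>p. norm (f p)) summable_on UNIV \<times> UNIV"
    unfolding Infinite_Sum.abs_summable_on_Sigma_iff by (intro conjI ballI inner_abs outer_abs)
  then have f: "(f has_sum infsum f (UNIV \<times> UNIV)) (UNIV \<times> UNIV)"
    by (rule has_sum_infsum[OF Infinite_Sum.abs_summable_summable])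
  show ?thesis
  proof (rule that)
    show "((\<lambda>m. w m * cinner (e m) (C (D (e m)))) has_sum infsum f (UNIV \<times> UNIV)) UNIV"
    proof (rule has_sum_SigmaD[OF f])
      fix m
      show "((\<lambda>n. f (m, n)) has_sum w m * cinner (e m) (C (D (e m)))) UNIV"
        using has_sum_cmult_right[OF parseval_has_sum[of "cadjoint C (e m)" "D (e m)"], of "w m"]
        by (simp add: f_def cinner_cadjoint[OF C])
    qed
    have f': "((\<lambda>(n, m). f (m, n)) has_sum infsum f (UNIV \<times> UNIV)) (UNIV \<times> UNIV)"
      using f by (subst (asm) has_sum_swap)
    show "((\<lambda>n. cinner (e n) (D (K (C (e n))))) has_sum infsum f (UNIV \<times> UNIV)) UNIV"
    proof (rule has_sum_SigmaD[OF f'])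
      fix n
      \<comment> \<open>By continuity <e n, D .> can be applied term by term to the series for
        \<open>K (C (e n))\<close>, which recovers the entries of \<open>f\<close> in the other
        order.\<close>
      have "bounded_linear (\<lambda>x. cinner (e n) (D x))"
        by (rule bounded_linear_compose[OF bounded_linear_cinner_right
              bounded_op_imp_bounded_linear[OF D]])
      from has_sum_bounded_linear[OF this K[of "C (e n)"]]
      show "((\<lambda>m. case (n, m) of (n, m) \<Rightarrow> f (m, n)) has_sum cinner (e n) (D (K (C (e n))))) UNIV"
        by (simp add: f_def bounded_op_scaleC[OF D] cinner_scaleC_right mult.assoc)
    qed
  qed
qed

end

section \<open>The number operator\<close>

text \<open>The value of \<open>op_adjoint\<close> is a definite description. Density of the domain
  makes its witness unique, so x' really satisfies the adjoint relation, which is then evaluated at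
  \<open>y\<close>.\<close>

lemma self_adjoint_symmetric:
  fixes S :: "'a::complex_hilbert \<rightharpoonup> 'a"
  assumes S: "self_adjoint S" and xy: "S x = Some x'" "S y = Some y'"
  shows "cinner x' y = cinner x y'"
proof -
  have adj: "op_adjoint S x = Some x'" and dense: "closure (dom S) = UNIV"
    using S xy by (auto simp: self_adjoint_def)
  let ?P = "\<lambda>z. \<forall>u\<in>dom S. cinner z u = cinner x (the (S u))"
  have ex: "\<exists>z. ?P z" and x': "x' = (THE z. ?P z)"
    using adj by (auto simp: op_adjoint_def split: if_splits)
  have "z = z'" if "?P z" "?P z'" for z z'
  proof -
    have "cinner u (z - z') = 0" if "u \<in> dom S" for u
      using \<open>?P z\<close> \<open>?P z'\<close> that
      by (simp add: cinner_diff_right cinner_commute[of u z] cinner_commute[of u z'])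
    then show ?thesis using cinner_dense_eq_0[OF dense, of "z - z'"] by simp
  qed
  then have "\<exists>!z. ?P z" using ex by blast
  from theI'[OF this] have "?P x'" by (simp add: x')
  then show ?thesis using xy(2) by force
qed

locale number_operator = onb e for e :: "nat \<Rightarrow> 'a::complex_hilbert" +
  fixes H0 :: "'a \<rightharpoonup> 'a"
  assumes self_adjoint: "self_adjoint H0"
    and H0_basis: "H0 (e n) = Some (of_nat n *\<^sub>C e n)"
begin

text \<open>Symmetry of \<open>H0\<close> between \<open>e n\<close> and \<open>x\<close>. An
  eigenvector for \<open>l\<close> thus has no component along \<open>e n\<close> unless l = n,
  which determines both the eigenvalues and the eigenspaces.\<close>

lemma eigenvector_coeff:
  assumes "H0 x = Some (l *\<^sub>C x)"
  shows "of_nat n * cinner (e n) x = l * cinner (e n) x"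
  using self_adjoint_symmetric[OF self_adjoint H0_basis[of n] assms]
  by (simp add: cinner_scaleC_left cinner_scaleC_right)

lemma H0_scaleC:
  assumes "H0 x = Some y"
  shows "H0 (c *\<^sub>C x) = Some (c *\<^sub>C y)"
proof -
  have lin: "op_linear H0" using self_adjoint by (simp add: self_adjoint_def)
  have x: "x \<in> dom H0" using assms by auto
  then have "c *\<^sub>C x \<in> dom H0" using lin by (simp add: op_linear_def cvec.subspace_scale)
  moreover have "the (H0 (c *\<^sub>C x)) = c *\<^sub>C the (H0 x)" using lin x by (simp add: op_linear_def)
  ultimately show ?thesis using assms by auto
qed

lemma eigenspace_H0: "eigenspace H0 (of_nat n) = range (\<lambda>c. c *\<^sub>C e n)"
proof (intro equalityI subsetI)
  fix x assume "x \<in> eigenspace H0 (of_nat n)"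
  then have x: "H0 x = Some (of_nat n *\<^sub>C x)" by (simp add: eigenspace_def)
  have "x - cinner (e n) x *\<^sub>C e n = 0"
  proof (rule basis_coeffs_0_imp_0)
    fix m
    show "cinner (e m) (x - cinner (e n) x *\<^sub>C e n) = 0"
      using eigenvector_coeff[OF x, of m]
      by (auto simp: cinner_diff_right cinner_scaleC_right cinner_basis)
  qed
  then show "x \<in> range (\<lambda>c. c *\<^sub>C e n)" by (metis eq_iff_diff_eq_0 rangeI)
next
  fix x assume "x \<in> range (\<lambda>c. c *\<^sub>C e n)"
  then show "x \<in> eigenspace H0 (of_nat n)"
    using H0_scaleC[OF H0_basis] by (auto simp: eigenspace_def scaleC_scaleC mult.commute)
qed

lemma eigenvalues_H0: "eigenvalues H0 = range of_nat"
proof (intro equalityI subsetI)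
  fix l assume "l \<in> eigenvalues H0"
  then obtain x where x: "H0 x = Some (l *\<^sub>C x)" "x \<noteq> 0"
    by (auto simp: eigenvalues_def eigenspace_def)
  then obtain n where "cinner (e n) x \<noteq> 0" using basis_coeffs_0_imp_0 by blast
  then have "l = of_nat n" using eigenvector_coeff[OF x(1), of n] by simp
  then show "l \<in> range of_nat" by simp
next
  fix l :: complex assume "l \<in> range of_nat"
  then obtain n where "l = of_nat n" by blast
  then show "l \<in> eigenvalues H0"
    using H0_basis[of n] basis_neq_0[of n] by (auto simp: eigenvalues_def eigenspace_def)
qed

lemma orth_proj_eigenspace: "orth_proj (eigenspace H0 (of_nat n)) x = cinner (e n) x *\<^sub>C e n"
  unfolding orth_proj_def eigenspace_H0
proof (rule the_equality)
  show "cinner (e n) x *\<^sub>C e n \<in> range (\<lambda>c. c *\<^sub>C e n) \<and>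
      (\<forall>z\<in>range (\<lambda>c. c *\<^sub>C e n). cinner z (x - cinner (e n) x *\<^sub>C e n) = 0)"
    by (auto simp: cinner_scaleC_left cinner_diff_right cinner_scaleC_right cinner_basis)
next
  fix y assume y: "y \<in> range (\<lambda>c. c *\<^sub>C e n) \<and> (\<forall>z\<in>range (\<lambda>c. c *\<^sub>C e n). cinner z (x - y) = 0)"
  then obtain c where c: "y = c *\<^sub>C e n" by blast
  \<comment> \<open>The scalar 1 exhibits \<open>e n\<close> as a member of the range over which
    \<open>y\<close> is tested.\<close>
  have "cinner (1 *\<^sub>C e n) (x - y) = 0" using y by blast
  then show "y = cinner (e n) x *\<^sub>C e n"
    by (simp add: c scaleC_one cinner_diff_right cinner_scaleC_right cinner_basis)
qed

section \<open>Exponentials of the number operator\<close>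

lemma exp_op_H0:
  assumes "(\<lambda>n. (cmod (exp (z * of_nat n)))\<^sup>2 * (cmod (cinner (e n) x))\<^sup>2) summable_on UNIV"
  shows "exp_op z H0 x = Some (\<Sum>\<^sub>\<infinity>n. exp (z * of_nat n) *\<^sub>C (cinner (e n) x *\<^sub>C e n))"
proof -
  \<comment> \<open>The functional calculus sums over complex eigenvalues; injectivity of the
    embedding of the naturals turns this into a sum over \<open>n\<close>.\<close>
  have inj: "inj (of_nat :: nat \<Rightarrow> complex)" by (simp add: inj_on_def)
  show ?thesis
    using assms
    by (simp add: exp_op_def fun_calc_def eigenvalues_H0 summable_on_reindex[OF inj]
        infsum_reindex[OF inj] o_def orth_proj_eigenspace norm_scaleC)
qed

text \<open>Only the \<open>n\<close>-th coefficient is nonzero, so the domain condition holds for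
  every complex \<open>z\<close>, including those for which the exponential is unbounded.\<close>

lemma exp_op_H0_basis: "exp_op z H0 (c *\<^sub>C e n) = Some (c *\<^sub>C (exp (z * of_nat n) *\<^sub>C e n))"
proof -
  have "((\<lambda>m. (cmod (exp (z * of_nat m)))\<^sup>2 * (cmod (cinner (e m) (c *\<^sub>C e n)))\<^sup>2) has_sum
      (\<Sum>m\<in>{n}. (cmod (exp (z * of_nat m)))\<^sup>2 * (cmod (cinner (e m) (c *\<^sub>C e n)))\<^sup>2)) UNIV"
    by (rule has_sum_finite_neutralI[of "{n}"]) (auto simp: cinner_scaleC_right cinner_basis)
  then have "exp_op z H0 (c *\<^sub>C e n) =
      Some (\<Sum>\<^sub>\<infinity>m. exp (z * of_nat m) *\<^sub>C (cinner (e m) (c *\<^sub>C e n) *\<^sub>C e m))"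
    by (intro exp_op_H0) (auto simp: summable_on_def)
  also have "(\<Sum>\<^sub>\<infinity>m. exp (z * of_nat m) *\<^sub>C (cinner (e m) (c *\<^sub>C e n) *\<^sub>C e m))
      = c *\<^sub>C (exp (z * of_nat n) *\<^sub>C e n)"
    by (rule infsumI, rule has_sum_finite_neutralI[of "{n}"])
      (auto simp: cinner_scaleC_right cinner_basis scaleC_scaleC mult.commute)
  finally show ?thesis .
qed

text \<open>The weights form a geometric sequence of ratio exp(-\<beta>) < 1, so the exponential is
  defined everywhere and can be replaced by a total function \<open>K\<close>. The series and the
  summable weights are the input of \<open>trace_cyclic\<close>.\<close>

lemma exp_op_H0_heat:
  assumes \<beta>: "\<beta> > 0"
  obtains K where "\<And>x. exp_op (- complex_of_real \<beta>) H0 x = Some (K x)"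
    and "\<And>x. ((\<lambda>n. exp (- complex_of_real \<beta> * of_nat n) *\<^sub>C (cinner (e n) x *\<^sub>C e n)) has_sum K x) UNIV"
    and "(\<lambda>n. cmod (exp (- complex_of_real \<beta> * of_nat n))) summable_on UNIV"
proof -
  define w where "w n = exp (- complex_of_real \<beta> * of_nat n)" for n
  have w: "cmod (w n) = exp (- \<beta>) ^ n" for n
    by (simp add: w_def exp_of_nat_mult[symmetric] mult.commute)
  have w1: "cmod (w n) \<le> 1" for n
    using \<beta> by (simp add: w power_le_one)
  have ws: "(\<lambda>n. cmod (w n)) summable_on UNIV"
    using \<beta> by (simp add: w summable_on_UNIV_nonneg_real_iff summable_geometric)
  have coeff: "cmod (cinner (e n) x) \<le> norm x" for n x
    using cauchy_schwarz[of "e n" x] by simp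
  have "(\<lambda>n. (cmod (w n))\<^sup>2 * (cmod (cinner (e n) x))\<^sup>2) summable_on UNIV" for x
  proof (rule summable_on_comparison_test)
    show "(\<lambda>n. cmod (w n) * (norm x)\<^sup>2) summable_on UNIV"
      by (rule summable_on_cmult_left[OF ws])
    \<comment> \<open>As the weights are at most 1, their squares are dominated by the weights
      themselves.\<close>
    show "(cmod (w n))\<^sup>2 * (cmod (cinner (e n) x))\<^sup>2 \<le> cmod (w n) * (norm x)\<^sup>2" for n
      using w1[of n] coeff[of n x]
      by (intro mult_mono power_mono) (auto simp: power2_eq_square mult_left_le)
  qed auto
  then have 1: "exp_op (- complex_of_real \<beta>) H0 x =
      Some (\<Sum>\<^sub>\<infinity>n. w n *\<^sub>C (cinner (e n) x *\<^sub>C e n))" for x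
    unfolding w_def by (rule exp_op_H0)
  have 2: "(\<lambda>n. w n *\<^sub>C (cinner (e n) x *\<^sub>C e n)) summable_on UNIV" for x
  proof (rule Infinite_Sum.abs_summable_summable, rule Infinite_Sum.abs_summable_on_comparison_test')
    show "(\<lambda>n. cmod (w n) * norm x) summable_on UNIV"
      by (rule summable_on_cmult_left[OF ws])
    show "norm (w n *\<^sub>C (cinner (e n) x *\<^sub>C e n)) \<le> cmod (w n) * norm x" for n
      unfolding norm_scaleC norm_basis using coeff[of n x] by (simp add: mult_left_mono)
  qed
  show ?thesis
    by (rule that[OF 1[unfolded w_def] has_sum_infsum[OF 2, unfolded w_def] ws[unfolded w_def]])
qed

end

theorem mainTheorem5:
  fixes e \<psi> :: "nat \<Rightarrow> 'a::complex_hilbert"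
    and H0 :: "'a \<rightharpoonup> 'a"
    and T A B :: "'a \<Rightarrow> 'a"
    and \<beta> :: real
  assumes "orthonormal_basis e"
    and "self_adjoint H0"
    and "\<And>n. H0 (e n) = Some (of_nat n *\<^sub>C e n)"
    and "bounded_op T" and "bij T" and "bounded_op (inv T)"
    and "\<And>n. \<psi> n = inv (cadjoint T) (e n)"
    and "\<beta> > 0"
    and "bounded_op A" and "bounded_op B"
  shows "omega_defined \<beta> \<psi> (everywhere A \<circ>\<^sub>m alpha_psi H0 T (\<i> * complex_of_real \<beta>) B) \<and>
         omega_defined \<beta> \<psi> (everywhere (T_conj T B \<circ> A)) \<and>
         omega \<beta> \<psi> (everywhere A \<circ>\<^sub>m alpha_psi H0 T (\<i> * complex_of_real \<beta>) B) =
         omega \<beta> \<psi> (everywhere (T_conj T B \<circ> A))"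
proof -
  interpret number_operator e H0
    by unfold_locales (fact assms)+
  note T = \<open>bounded_op T\<close> and T' = \<open>bounded_op (inv T)\<close> and \<psi> = assms(7)
  define R where "R = cadjoint T"
  define S where "S = cadjoint (inv T)"
  have "S \<circ> R = id"
    unfolding S_def R_def using assms(5) T T'
    by (intro cadjoint_compose_inv) (auto simp: bij_def surj_iff)
  moreover have "R \<circ> S = id"
    unfolding S_def R_def using assms(5) T T'
    by (intro cadjoint_compose_inv) (auto simp: bij_def)
  ultimately have inv_R: "inv R = S" and bij_R: "bij R" and RS [simp]: "R (S x) = x" for x
    by (auto simp: inv_unique_comp o_bij dest: fun_cong)
  have R: "bounded_op R" and S: "bounded_op S"
    by (simp_all add: R_def S_def bounded_op_cadjoint T T')
  have \<psi>S: "\<psi> n = S (e n)" for n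
    using \<psi> inv_R by (simp add: R_def)
  obtain K where K: "\<And>x. exp_op (- complex_of_real \<beta>) H0 x = Some (K x)"
    and K_sum: "\<And>x. ((\<lambda>n. exp (- complex_of_real \<beta> * of_nat n) *\<^sub>C (cinner (e n) x *\<^sub>C e n))
      has_sum K x) UNIV"
    and w: "(\<lambda>n. cmod (exp (- complex_of_real \<beta> * of_nat n))) summable_on UNIV"
    using exp_op_H0_heat[OF \<open>\<beta> > 0\<close>] by blast
  \<comment> \<open>Both sides are sums of the same series. Homogeneity lets the scalar exp(\<beta>
    n) pass through \<open>K\<close>.\<close>
  have K_scale: "K (c *\<^sub>C x) = c *\<^sub>C K x" for c x
    using K_sum[of "c *\<^sub>C x"] has_sum_bounded_linear[OF bounded_linear_scaleC K_sum[of x], of c]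
    by (intro has_sum_unique) (simp_all add: cinner_scaleC_right scaleC_scaleC ac_simps)
  define C where "C = R \<circ> B \<circ> S"
  define D where "D = inv T \<circ> A \<circ> S"
  have C: "bounded_op C" and D: "bounded_op D"
    unfolding C_def D_def by (intro bounded_op_compose R S T' assms)+
  let ?w = "\<lambda>n. exp (- complex_of_real \<beta> * of_nat n)"
  let ?X = "everywhere A \<circ>\<^sub>m alpha_psi H0 T (\<i> * complex_of_real \<beta>) B"
  let ?Y = "everywhere (T_conj T B \<circ> A)"
  obtain s where sX: "((\<lambda>n. cinner (e n) (D (K (C (e n))))) has_sum s) UNIV"
    and sY: "((\<lambda>n. ?w n * cinner (e n) (C (D (e n)))) has_sum s) UNIV"
    using trace_cyclic[OF w K_sum C D] by blast
  have w_real: "complex_of_real (exp (- \<beta> * real n)) = ?w n" for n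
    by (simp add: exp_of_real[symmetric])
  \<comment> \<open>Moving \<open>T\<close> across the inner product turns it into its adjoint,
    which cancels the inverse adjoint in \<psi>.\<close>
  have \<psi>_T: "cinner (\<psi> n) (T x) = cinner (e n) x" for n x
    by (simp add: \<psi>S cinner_cadjoint[OF T, symmetric] R_def[symmetric])
  have \<psi>_x: "cinner (\<psi> n) x = cinner (e n) (inv T x)" for n x
    using \<psi>_T[of n "inv T x"] assms(5) by (simp add: bij_def surj_f_inv_f)
  \<comment> \<open>At time i\<beta> the right-hand exponential is exp(\<beta> H0), unbounded but
    met only at \<open>e n\<close>, where it is a scalar; the left-hand one is \<open>K\<close>. The
    resulting \<open>Some\<close> also shows that \<psi> lies in the domain.\<close>
  have X: "?X (\<psi> n) = Some (A (S (exp (complex_of_real \<beta> * of_nat n) *\<^sub>C K (C (e n)))))" for n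
  proof -
    have "exp_op (complex_of_real \<beta>) H0 (e n) = Some (exp (complex_of_real \<beta> * of_nat n) *\<^sub>C e n)"
      using exp_op_H0_basis[of "complex_of_real \<beta>" 1 n] by (simp add: scaleC_one)
    moreover have "\<i> * (\<i> * complex_of_real \<beta>) = - complex_of_real \<beta>"
      by (simp flip: mult.assoc)
    ultimately show ?thesis
      by (simp add: alpha_psi_def alpha_0_def everywhere_def \<psi>S inv_R R_def[symmetric] K
          C_def[symmetric] bounded_op_scaleC[OF C] K_scale)
  qed
  have X_term: "complex_of_real (exp (- \<beta> * real n)) * cinner (\<psi> n) (the (?X (\<psi> n)))
      = cinner (e n) (D (K (C (e n))))" for n
  proof -
    have "cinner (\<psi> n) (the (?X (\<psi> n)))
        = exp (complex_of_real \<beta> * of_nat n) * cinner (e n) (D (K (C (e n))))"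
      by (simp add: X \<psi>_x D_def bounded_op_scaleC[OF S] bounded_op_scaleC[OF T']
          bounded_op_scaleC[OF \<open>bounded_op A\<close>] cinner_scaleC_right)
    then show ?thesis
      unfolding w_real by (simp add: mult.assoc[symmetric] exp_add[symmetric])
  qed
  have "inv (T \<circ> R) = S \<circ> inv T"
    using o_inv_distrib[OF assms(5) bij_R] by (simp add: inv_R)
  \<comment> \<open>The outer \<open>T\<close> of \<open>T_conj\<close> is absorbed by the left-hand
    \<psi>, leaving C D. The definition of \<psi> is unfolded only in the second simplification,
    since \<open>\<psi>_T\<close> has to match first.\<close>
  then have Y_term: "complex_of_real (exp (- \<beta> * real n)) * cinner (\<psi> n) (the (?Y (\<psi> n)))
      = ?w n * cinner (e n) (C (D (e n)))" for n
    unfolding w_real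
    by (simp add: everywhere_def T_conj_def R_def[symmetric] \<psi>_T C_def D_def) (simp add: \<psi>S)
  \<comment> \<open>Boundedness of \<open>S\<close> makes the norms of \<psi> uniformly bounded, so
    the geometric weights dominate.\<close>
  have Z: "summable (\<lambda>n. exp (- \<beta> * real n) * (norm (\<psi> n))\<^sup>2)"
  proof -
    obtain k where k: "k \<ge> 0" "\<And>x. norm (S x) \<le> k * norm x"
      using bounded_op_bound[OF S] by blast
    show ?thesis
    proof (rule summable_comparison_test'[where N = 0])
      show "summable (\<lambda>n. cmod (?w n) * k\<^sup>2)"
        by (intro summable_mult2 summable_on_imp_summable w)
      show "norm (exp (- \<beta> * real n) * (norm (\<psi> n))\<^sup>2) \<le> cmod (?w n) * k\<^sup>2" for n
        using k(2)[of "e n"] by (simp add: \<psi>S power_mono)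
    qed
  qed
  \<comment> \<open>For complex series unordered summability is already absolute, so the two
    \<open>has_sum\<close> facts also supply the convergence that \<open>omega_defined\<close>
    demands.\<close>
  have abs: "summable (\<lambda>n. cmod (f n))" if "(f has_sum s) UNIV" for f :: "nat \<Rightarrow> complex"
    using that summable_on_iff_abs_summable_on_complex[of f UNIV]
    by (auto intro: summable_on_imp_summable has_sum_imp_summable)
  have "omega_defined \<beta> \<psi> ?X"
    unfolding omega_defined_def X_term using Z abs[OF sX] X by auto
  moreover have "omega_defined \<beta> \<psi> ?Y"
    unfolding omega_defined_def Y_term using Z abs[OF sY] by (auto simp: everywhere_def)
  moreover have "omega \<beta> \<psi> ?X = omega \<beta> \<psi> ?Y"
    unfolding omega_def X_term Y_term
    using sums_unique[OF has_sum_imp_sums[OF sX]] sums_unique[OF has_sum_imp_sums[OF sY]] by simp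
  ultimately show ?thesis by blast
qed

end
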